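(* Let $K$ be a field, let $G=(V,E,w)$ be a connected weighted simple graph with vertices $t_1,\ldots,t_s$ and positive integer edge weights, and let $I\subset S=K[t_1,\ldots,t_s]$ be its Laplacian ideal. If $|E(t_i)|\geq 2$ for all $i$, then $I$ is an almost complete intersection.
   Context: $E(t_i)$ is the set of edges incident to $t_i$. The Laplacian matrix $L(G)$ has entries $L(G)_{i,i}=\sum_{e\in E(t_i)}w_e$ and, for $i\neq j$, $L(G)_{i,j}=-w_e$ if $e=\{t_i,t_j\}\in E$ and $0$ otherwise. For $a\in\mathbb{Z}^s$ write $a=a^+-a^-$ with $a^\pm\in\mathbb{N}^s$ of disjoint support, and $t^c=t_1^{c_1}\cdots t_s^{c_s}$. The Laplacian ideal of $G$ is the ideal of $S$ generated by the binomials $t^{a^+}-t^{a^-}$ where $a$ runs over the columns of $L(G)$. An ideal $I$ is an almost complete intersection if its minimal number of generators equals ${\rm ht}(I)+1$. *)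

theory Defs
  imports
    "HOL-Library.Poly_Mapping"
    "HOL-Library.Extended_Nat"
    "HOL-Analysis.Finite_Cartesian_Product"
    "HOL-Algebra.Algebraic_Closure_Type"
begin

text \<open>
  The vertices are the elements of a finite type, which also indexes the variables of the
  polynomial ring. An edge is the two-element set of its end points.
\<close>

locale connected_weighted_graph =
  fixes E :: "'v::finite set set" and w :: "'v set \<Rightarrow> nat"
  assumes simple: "e \<in> E \<Longrightarrow> card e = 2"
    and positive_weight: "e \<in> E \<Longrightarrow> 0 < w e"
    and connected: "(u, v) \<in> {(x, y). {x, y} \<in> E}\<^sup>*"

definition incident_edges :: "'v set set \<Rightarrow> 'v \<Rightarrow> 'v set set"
  where "incident_edges E i = {e \<in> E. i \<in> e}"

definition laplacian_matrix :: "'v::finite set set \<Rightarrow> ('v set \<Rightarrow> nat) \<Rightarrow> int ^ 'v ^ 'v"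
  where "laplacian_matrix E w =
    (\<chi> i j. if i = j then \<Sum>e\<in>incident_edges E i. int (w e)
           else if {i, j} \<in> E then - int (w {i, j}) else 0)"

definition pos_part :: "int ^ 'v \<Rightarrow> nat ^ 'v::finite"
  where "pos_part a = (\<chi> i. nat (a $ i))"

definition neg_part :: "int ^ 'v \<Rightarrow> nat ^ 'v::finite"
  where "neg_part a = (\<chi> i. nat (- (a $ i)))"

text \<open>
  Polynomials over \<open>'k\<close> in the variables \<open>'v\<close>, as finitely supported functions from exponent
  vectors to coefficients, with the convolution product.
\<close>

type_synonym ('v, 'k) mpolynomial = "('v \<Rightarrow>\<^sub>0 nat) \<Rightarrow>\<^sub>0 'k"

definition var :: "'v \<Rightarrow> ('v, 'k::comm_ring_1) mpolynomial"
  where "var i = Poly_Mapping.single (Poly_Mapping.single i 1) 1"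

definition monomial :: "nat ^ 'v::finite \<Rightarrow> ('v, 'k::comm_ring_1) mpolynomial"
  where "monomial c = (\<Prod>i\<in>UNIV. var i ^ (c $ i))"

definition polynomial_ring :: "('v::finite, 'k::field) mpolynomial ring"
  where "polynomial_ring = ring_of_type_algebra"

definition laplacian_ideal ::
    "'v::finite set set \<Rightarrow> ('v set \<Rightarrow> nat) \<Rightarrow> ('v, 'k::field) mpolynomial set"
  where "laplacian_ideal E w =
    genideal polynomial_ring
      ((\<lambda>a. monomial (pos_part a) - monomial (neg_part a)) ` columns (laplacian_matrix E w))"

text \<open>The value is \<open>\<infinity>\<close> if there is no finite generating set.\<close>

definition min_num_generators :: "('a, 'b) ring_scheme \<Rightarrow> 'a set \<Rightarrow> enat"
  where "min_num_generators R I =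
    (INF B\<in>{B. finite B \<and> B \<subseteq> carrier R \<and> genideal R B = I}. enat (card B))"

text \<open>Supremum of the lengths \<open>n\<close> of chains \<open>P\<^sub>0 \<subset> \<dots> \<subset> P\<^sub>n = P\<close> of prime ideals.\<close>

definition prime_height :: "('a, 'b) ring_scheme \<Rightarrow> 'a set \<Rightarrow> enat"
  where "prime_height R P =
    (SUP n\<in>{n. \<exists>Q. (\<forall>i\<le>n. primeideal (Q i) R) \<and> (\<forall>i<n. Q i \<subset> Q (Suc i)) \<and> Q n = P}. enat n)"

definition ideal_height :: "('a, 'b) ring_scheme \<Rightarrow> 'a set \<Rightarrow> enat"
  where "ideal_height R I = (INF P\<in>{P. primeideal P R \<and> I \<subseteq> P}. prime_height R P)"

text \<open>
  Finiteness is required because \<open>\<infinity> = \<infinity> + 1\<close> in \<^typ>\<open>enat\<close>; it is automatic for ideals of a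
  Noetherian ring.
\<close>

definition almost_complete_intersection :: "('a, 'b) ring_scheme \<Rightarrow> 'a set \<Rightarrow> bool"
  where "almost_complete_intersection R I \<longleftrightarrow>
    ideal I R \<and> min_num_generators R I \<noteq> \<infinity> \<and> min_num_generators R I = ideal_height R I + 1"

end

theory Submission
  imports Defs "HOL-Analysis.Cartesian_Space"
begin

text \<open>
  Let \<open>s\<close> be the number of vertices. The Laplacian ideal \<open>I\<close> is generated by the \<open>s\<close> binomials
  \<open>f\<^sub>i = t\<^sub>i\<^bsup>d(i)\<^esup> - \<Prod>\<^sub>j t\<^sub>j\<^bsup>w(i,j)\<^esup>\<close>. As every vertex has two neighbours, the pure power
  \<open>t\<^sub>i\<^bsup>d(i)\<^esup>\<close> is divisible by no other monomial of the \<open>f\<^sub>j\<close>, so that on \<open>I\<close> its coefficient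
  is additive and turns multiplication by \<open>g\<close> into multiplication by \<open>g(0)\<close>. These \<open>s\<close> coefficients
  show that \<open>I\<close> needs \<open>s\<close> generators.

  The height is \<open>s - 1\<close>. The \<open>f\<^sub>i\<close> are homogeneous and vanish at \<open>(1, \<dots>, 1)\<close>, so \<open>I\<close> lies in the prime
  ideal of the diagonal line, which is properly contained in the ideal of the origin; as chains of
  primes have length at most \<open>s\<close>, its height is at most \<open>s - 1\<close>. Conversely, a prime \<open>P\<close> above \<open>I\<close> that
  contains a variable contains all of them by connectedness, hence contains the diagonal prime. If it
  contains no variable, then for all \<open>u\<close>, \<open>v\<close> it contains some \<open>t\<^sub>u\<^sup>N - t\<^sub>v\<^sup>N\<close>, because the image of the
  Laplacian matrix has finite index in the vectors of coordinate sum \<open>0\<close>. Replacing \<open>P\<close> successively by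
  the largest ideal inside it that is homogeneous in one more variable \<open>t\<^sub>u\<close>, for all \<open>u \<noteq> v\<close>, gives a
  strictly descending chain of \<open>s\<close> primes.
\<close>

section \<open>Ideals and prime ideals when the ring is a whole type\<close>

abbreviation type_ring :: "'a::comm_ring_1 ring"
  where "type_ring \<equiv> ring_of_type_algebra"

lemma ring_of_type_algebra_simps [simp]:
  "carrier (type_ring :: 'a::comm_ring_1 ring) = UNIV"
  "a \<otimes>\<^bsub>type_ring\<^esub> b = a * b"
  "a \<oplus>\<^bsub>type_ring\<^esub> b = a + b"
  "\<zero>\<^bsub>type_ring\<^esub> = (0 :: 'a)"
  "\<one>\<^bsub>type_ring\<^esub> = (1 :: 'a)"
  by (simp_all add: ring_of_type_algebra_def)

text \<open>Closure under negation comes from multiplication by -1, so sums and multiples describe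
  ideals completely.\<close>

lemma ideal_type_ring_iff:
  fixes J :: "'a::comm_ring_1 set"
  shows "ideal J type_ring \<longleftrightarrow>
    0 \<in> J \<and> (\<forall>a\<in>J. \<forall>b\<in>J. a + b \<in> J) \<and> (\<forall>a\<in>J. \<forall>x. x * a \<in> J)"
proof
  assume "ideal J type_ring"
  then interpret ideal J type_ring .
  show "0 \<in> J \<and> (\<forall>a\<in>J. \<forall>b\<in>J. a + b \<in> J) \<and> (\<forall>a\<in>J. \<forall>x. x * a \<in> J)"
    using additive_subgroup.zero_closed[OF additive_subgroup_axioms]
      additive_subgroup.a_closed[OF additive_subgroup_axioms] I_l_closed by simp
next
  assume J: "0 \<in> J \<and> (\<forall>a\<in>J. \<forall>b\<in>J. a + b \<in> J) \<and> (\<forall>a\<in>J. \<forall>x. x * a \<in> J)"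
  interpret R: cring "type_ring :: 'a ring" by (rule cring_from_type_algebra)
  have neg: "- a \<in> J" if "a \<in> J" for a
    using J that by (metis mult_minus1)
  have inv: "inv\<^bsub>add_monoid type_ring\<^esub> a = - a" for a :: 'a
    using R.minus_equality[of "- a" a] by (simp add: a_inv_def)
  show "ideal J type_ring"
  proof (rule idealI)
    show "ring (type_ring :: 'a ring)" by (rule ring_from_type_algebra)
    show "subgroup J (add_monoid type_ring)"
      by (rule subgroup.intro) (use J neg inv in auto)
  qed (use J in \<open>auto simp: mult.commute\<close>)
qed

lemma primeideal_type_ring_iff:
  fixes P :: "'a::comm_ring_1 set"
  shows "primeideal P type_ring \<longleftrightarrow>
    ideal P type_ring \<and> 1 \<notin> P \<and> (\<forall>a b. a * b \<in> P \<longrightarrow> a \<in> P \<or> b \<in> P)"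
proof
  assume "primeideal P type_ring"
  then interpret primeideal P type_ring .
  show "ideal P type_ring \<and> 1 \<notin> P \<and> (\<forall>a b. a * b \<in> P \<longrightarrow> a \<in> P \<or> b \<in> P)"
    using I_notcarr I_prime one_imp_carrier is_ideal by auto
next
  assume P: "ideal P type_ring \<and> 1 \<notin> P \<and> (\<forall>a b. a * b \<in> P \<longrightarrow> a \<in> P \<or> b \<in> P)"
  show "primeideal P type_ring"
    by (rule primeidealI) (use P cring_from_type_algebra in auto)
qed

context
  fixes J :: "'a::comm_ring_1 set"
  assumes J: "ideal J type_ring"
begin

lemma ideal_zero: "0 \<in> J"
  using J by (simp add: ideal_type_ring_iff)

lemma ideal_add: "a \<in> J \<Longrightarrow> b \<in> J \<Longrightarrow> a + b \<in> J"
  using J by (simp add: ideal_type_ring_iff)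

lemma ideal_mult_left: "a \<in> J \<Longrightarrow> x * a \<in> J"
  using J by (simp add: ideal_type_ring_iff)

lemma ideal_mult_right: "a \<in> J \<Longrightarrow> a * x \<in> J"
  using ideal_mult_left by (simp add: mult.commute)

lemma ideal_diff: "a \<in> J \<Longrightarrow> b \<in> J \<Longrightarrow> a - b \<in> J"
  using ideal_add[of a "- b"] ideal_mult_left[of b "- 1"] by simp

lemma ideal_sum: "(\<And>x. x \<in> A \<Longrightarrow> f x \<in> J) \<Longrightarrow> sum f A \<in> J"
  by (induction A rule: infinite_finite_induct) (auto intro: ideal_zero ideal_add)

lemma ideal_add_cancel: "a \<in> J \<Longrightarrow> a + b \<in> J \<longleftrightarrow> b \<in> J"
  using ideal_add ideal_diff by fastforce

end

lemma primeideal_ideal: "primeideal P R \<Longrightarrow> ideal P R"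
  by (rule primeideal.axioms)

lemma primeideal_mult:
  "primeideal P type_ring \<Longrightarrow> a * b \<in> P \<Longrightarrow> a \<in> P \<or> b \<in> P"
  by (simp add: primeideal_type_ring_iff)

lemma primeideal_one: "primeideal P type_ring \<Longrightarrow> 1 \<notin> P"
  by (simp add: primeideal_type_ring_iff)

lemma primeideal_power: "primeideal P type_ring \<Longrightarrow> a ^ n \<in> P \<Longrightarrow> a \<in> P"
  by (induction n) (auto simp: primeideal_one dest: primeideal_mult)

lemma primeideal_prod:
  "primeideal P type_ring \<Longrightarrow> prod f A \<in> P \<Longrightarrow> \<exists>x\<in>A. f x \<in> P"
  by (induction A rule: infinite_finite_induct) (auto simp: primeideal_one dest: primeideal_mult)

text \<open>The quotient embeds into a domain. The primes of the origin and of the point (1, ..., 1)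
  are obtained in this way.\<close>

lemma primeideal_kernel:
  fixes h :: "'a::comm_ring_1 \<Rightarrow> 'b::idom"
  assumes "\<And>a b. h (a + b) = h a + h b" "\<And>a b. h (a * b) = h a * h b" "h 1 = 1"
  shows "primeideal {a. h a = 0} type_ring"
proof -
  have "h 0 = 0"
    using assms(1)[of 0 0] by (simp only: add_0_left add_cancel_right_left)
  then show ?thesis
    using assms by (auto simp: primeideal_type_ring_iff ideal_type_ring_iff)
qed

abbreviation lookup :: "('a \<Rightarrow>\<^sub>0 'b::zero) \<Rightarrow> 'a \<Rightarrow> 'b"
  where "lookup \<equiv> Poly_Mapping.lookup"

abbreviation keys :: "('a \<Rightarrow>\<^sub>0 'b::zero) \<Rightarrow> 'a set"
  where "keys \<equiv> Poly_Mapping.keys"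

abbreviation single :: "'a \<Rightarrow> 'b \<Rightarrow> 'a \<Rightarrow>\<^sub>0 'b::zero"
  where "single \<equiv> Poly_Mapping.single"

section \<open>Homogeneous cores of prime ideals\<close>

lemma poly_mapping_expand: "f = (\<Sum>m\<in>keys f. single m (lookup f m))"
  by (rule poly_mapping_eqI)
    (simp add: lookup_sum lookup_single when_def in_keys_iff)

lemma poly_mapping_induct_add [case_names monom add]:
  fixes f :: "'m \<Rightarrow>\<^sub>0 'k::comm_monoid_add"
  assumes "\<And>m c. Q (single m c)" "\<And>f g. Q f \<Longrightarrow> Q g \<Longrightarrow> Q (f + g)"
  shows "Q f"
proof -
  have "Q 0"
    using assms(1)[of undefined 0] by simp
  then have "Q (sum (\<lambda>m. single m (lookup f m)) A)" for A
    by (induction A rule: infinite_finite_induct) (auto intro: assms)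
  from this[of "keys f"] show ?thesis
    by (simp flip: poly_mapping_expand)
qed

text \<open>The function \<open>\<gamma>\<close> serves as a grading of the monomials: the total
  degree, or the degree in a single variable.\<close>

definition component :: "('m \<Rightarrow> nat) \<Rightarrow> nat \<Rightarrow> ('m \<Rightarrow>\<^sub>0 'k::comm_monoid_add) \<Rightarrow> 'm \<Rightarrow>\<^sub>0 'k"
  where "component \<gamma> n f =
    (\<Sum>m\<in>{m \<in> keys f. \<gamma> m = n}. single m (lookup f m))"

lemma lookup_component: "lookup (component \<gamma> n f) m = (lookup f m when \<gamma> m = n)"
  by (auto simp: component_def lookup_sum lookup_single when_def in_keys_iff)

lemma component_add: "component \<gamma> n (f + g) = component \<gamma> n f + component \<gamma> n g"
  by (rule poly_mapping_eqI) (simp add: lookup_component lookup_add when_add_distrib)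

lemma component_diff:
  "component \<gamma> n (f - g) = component \<gamma> n f - component \<gamma> n (g :: _ \<Rightarrow>\<^sub>0 'k::ab_group_add)"
  by (rule poly_mapping_eqI) (simp add: lookup_component lookup_minus when_diff_distrib)

lemma component_zero [simp]: "component \<gamma> n 0 = 0"
  by (simp add: component_def)

lemma component_single: "component \<gamma> n (single m c) =
    (if \<gamma> m = n then single m c else 0)"
  by (rule poly_mapping_eqI) (auto simp: lookup_component lookup_single when_def)

lemma sum_component: "f = (\<Sum>n\<in>\<gamma> ` keys f. component \<gamma> n f)"
  by (rule poly_mapping_eqI)
    (auto simp: lookup_sum lookup_component when_def in_keys_iff)

text \<open>Both sides are additive in \<open>f\<close> and in \<open>g\<close>. For two single
  terms at most the summand with \<open>i = \<gamma> p\<close> is nonzero.\<close>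

lemma component_mult:
  fixes f g :: "'m::monoid_add \<Rightarrow>\<^sub>0 'k::comm_ring_1"
  assumes \<gamma>: "\<And>p q. \<gamma> (p + q) = \<gamma> p + \<gamma> q"
  shows "component \<gamma> n (f * g) = (\<Sum>i\<le>n. component \<gamma> i f * component \<gamma> (n - i) g)"
proof (induction f rule: poly_mapping_induct_add)
  case (add f1 f2)
  then show ?case
    by (simp add: distrib_right component_add sum.distrib)
next
  case (monom p c)
  show ?case
  proof (induction g rule: poly_mapping_induct_add)
    case (add g1 g2)
    then show ?case
      by (simp add: distrib_left component_add sum.distrib)
  next
    case (monom q d)
    have "(\<Sum>i\<le>n. component \<gamma> i (single p c) * component \<gamma> (n - i) (single q d))
        = (\<Sum>i\<le>n. if i = \<gamma> p then (if \<gamma> p + \<gamma> q = n then single (p + q) (c * d) else 0) else 0)"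
      by (rule sum.cong) (auto simp: component_single mult_single)
    also have "\<dots> = component \<gamma> n (single p c * single q d)"
      by (auto simp: component_single mult_single \<gamma>)
    finally show ?case ..
  qed
qed

text \<open>For an additive \<open>\<gamma>\<close> and an ideal \<open>P\<close>, this is the
  largest \<open>\<gamma>\<close>-homogeneous ideal contained in \<open>P\<close>.\<close>

definition homogeneous_core :: "('m \<Rightarrow> nat) \<Rightarrow> ('m \<Rightarrow>\<^sub>0 'k::comm_monoid_add) set \<Rightarrow> ('m \<Rightarrow>\<^sub>0 'k) set"
  where "homogeneous_core \<gamma> P = {f. \<forall>n. component \<gamma> n f \<in> P}"

context
  fixes \<gamma> :: "'m::comm_monoid_add \<Rightarrow> nat" and P :: "('m \<Rightarrow>\<^sub>0 'k::comm_ring_1) set"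
  assumes \<gamma>: "\<And>p q. \<gamma> (p + q) = \<gamma> p + \<gamma> q"
begin

lemma ideal_homogeneous_core:
  assumes "ideal P type_ring"
  shows "ideal (homogeneous_core \<gamma> P) type_ring"
  unfolding ideal_type_ring_iff homogeneous_core_def
  by (auto simp: component_add component_mult[OF \<gamma>] intro!: ideal_sum
      intro: ideal_zero ideal_add ideal_mult_left assms)

lemma homogeneous_core_subset:
  assumes "ideal P type_ring"
  shows "homogeneous_core \<gamma> P \<subseteq> P"
proof
  fix f assume "f \<in> homogeneous_core \<gamma> P"
  then have "(\<Sum>n\<in>\<gamma> ` keys f. component \<gamma> n f) \<in> P"
    by (intro ideal_sum assms) (simp add: homogeneous_core_def)
  then show "f \<in> P"
    by (simp flip: sum_component)
qed

text \<open>Let \<open>a\<close> and \<open>b\<close> be the lowest degrees in which components of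
  \<open>f\<close> and \<open>g\<close> leave \<open>P\<close>. In degree \<open>a + b\<close> of
  the product, every other summand has a factor of lower degree, which lies in \<open>P\<close>; so
  the product of these two components would lie in \<open>P\<close> as well.\<close>

lemma primeideal_homogeneous_core:
  assumes P: "primeideal P type_ring"
  shows "primeideal (homogeneous_core \<gamma> P) type_ring"
proof -
  note I = primeideal_ideal[OF P]
  have "f \<in> homogeneous_core \<gamma> P \<or> g \<in> homogeneous_core \<gamma> P"
    if fg: "f * g \<in> homogeneous_core \<gamma> P" for f g
  proof (rule ccontr)
    assume "\<not> ?thesis"
    then have ex: "\<exists>n. component \<gamma> n f \<notin> P" "\<exists>n. component \<gamma> n g \<notin> P"
      by (auto simp: homogeneous_core_def)
    define a where "a = (LEAST n. component \<gamma> n f \<notin> P)"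
    define b where "b = (LEAST n. component \<gamma> n g \<notin> P)"
    have a: "component \<gamma> a f \<notin> P" and b: "component \<gamma> b g \<notin> P"
      using LeastI_ex[OF ex(1)] LeastI_ex[OF ex(2)] unfolding a_def b_def .
    have less: "component \<gamma> n f \<in> P" if "n < a" for n
      using that not_less_Least unfolding a_def by blast
    have less': "component \<gamma> n g \<in> P" if "n < b" for n
      using that not_less_Least unfolding b_def by blast
    let ?t = "\<lambda>i. component \<gamma> i f * component \<gamma> (a + b - i) g"
    have "?t i \<in> P" if "i \<in> {..a + b} - {a}" for i
    proof (cases "i < a")
      case True
      then show ?thesis by (intro ideal_mult_right[OF I] less)
    next
      case False
      with that have "a + b - i < b" by auto
      then show ?thesis by (intro ideal_mult_left[OF I] less')
    qed
    then have "sum ?t ({..a + b} - {a}) \<in> P"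
      by (rule ideal_sum[OF I])
    moreover have "component \<gamma> (a + b) (f * g) = sum ?t ({..a + b} - {a}) + ?t a"
      by (subst component_mult[OF \<gamma>], subst sum.remove[of _ a]) auto
    moreover have "component \<gamma> (a + b) (f * g) \<in> P"
      using fg by (simp add: homogeneous_core_def)
    ultimately have "?t a \<in> P"
      by (simp add: ideal_add_cancel[OF I])
    then show False
      using a b primeideal_mult[OF P] by auto
  qed
  moreover have "1 \<notin> homogeneous_core \<gamma> P"
    using homogeneous_core_subset[OF I] primeideal_one[OF P] by blast
  ultimately show ?thesis
    using ideal_homogeneous_core[OF I] by (simp add: primeideal_type_ring_iff)
qed

end

section \<open>Chains of prime ideals\<close>

definition prime_chain :: "('a, 'b) ring_scheme \<Rightarrow> (nat \<Rightarrow> 'a set) \<Rightarrow> nat \<Rightarrow> bool"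
  where "prime_chain R Q n \<longleftrightarrow> (\<forall>i\<le>n. primeideal (Q i) R) \<and> (\<forall>i<n. Q i \<subset> Q (Suc i))"

lemma prime_height_eq_SUP:
  "prime_height R P = (SUP n\<in>{n. \<exists>Q. prime_chain R Q n \<and> Q n = P}. enat n)"
  by (simp add: prime_height_def prime_chain_def conj_assoc)

lemma prime_chain_snoc:
  assumes "prime_chain R Q n" "Q n \<subset> P" "primeideal P R"
  shows "prime_chain R (Q(Suc n := P)) (Suc n)"
  using assms unfolding prime_chain_def by (auto simp: less_Suc_eq le_Suc_eq)

lemma prime_chain_le_height: "prime_chain R Q n \<Longrightarrow> enat n \<le> prime_height R (Q n)"
  unfolding prime_height_eq_SUP by (rule SUP_upper) auto

lemma prime_height_le:
  "(\<And>Q n. prime_chain R Q n \<Longrightarrow> Q n = P \<Longrightarrow> n \<le> k) \<Longrightarrow> prime_height R P \<le> enat k"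
  unfolding prime_height_eq_SUP by (rule SUP_least) auto

section \<open>The dimension of a polynomial ring\<close>

context vector_space
begin

text \<open>The family need not be injective: a repeated value already gives a relation.\<close>

lemma dependent_family:
  assumes "finite A" "finite B" "f ` A \<subseteq> span B" "card B < card A"
  obtains c where "(\<Sum>a\<in>A. scale (c a) (f a)) = 0" "\<exists>a\<in>A. c a \<noteq> 0"
proof (cases "inj_on f A")
  case True
  have "dependent (f ` A)"
  proof (rule ccontr)
    assume "independent (f ` A)"
    then have "card (f ` A) \<le> card B"
      using assms by (intro independent_span_bound[THEN conjunct2]) auto
    then show False
      using assms True by (simp add: card_image)
  qed
  then obtain u where "\<exists>v\<in>f ` A. u v \<noteq> 0" "(\<Sum>v\<in>f ` A. scale (u v) v) = 0"
    using assms(1) by (auto simp: dependent_finite)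
  with True show ?thesis
    by (intro that[of "u \<circ> f"]) (auto simp: sum.reindex)
next
  case False
  then obtain x y where xy: "x \<in> A" "y \<in> A" "x \<noteq> y" "f x = f y"
    by (auto simp: inj_on_def)
  let ?c = "\<lambda>a. if a = x then 1 else if a = y then - 1 else 0"
  have "(\<Sum>a\<in>A. scale (?c a) (f a)) = (\<Sum>a\<in>{x, y}. scale (?c a) (f a))"
    by (rule sum.mono_neutral_right) (use xy assms(1) in auto)
  also have "\<dots> = 0"
    using xy by auto
  finally show ?thesis
    using xy(1) by (intro that[of ?c]) auto
qed

end

definition const :: "'k::comm_ring_1 \<Rightarrow> ('v, 'k) mpolynomial"
  where "const c = single 0 c"

text \<open>Scalars act through constant polynomials, which makes spans and linear dependence over
  the field available for the counting argument.\<close>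

interpretation mpoly: vector_space "\<lambda>c (f :: ('v, 'k::field) mpolynomial). const c * f"
proof
  fix a b :: 'k and f :: "('v, 'k) mpolynomial"
  have "const a * const b = (const (a * b) :: ('v, 'k) mpolynomial)"
    by (simp add: const_def mult_single)
  then show "const a * (const b * f) = const (a * b) * f"
    by (metis mult.assoc)
qed (simp_all add: const_def single_add algebra_simps)

text \<open>Bounding each variable separately instead of the total degree makes the admissible
  monomials a box, which is easy to count.\<close>

definition bounded_degrees :: "nat \<Rightarrow> ('v, 'k::zero) mpolynomial \<Rightarrow> bool"
  where "bounded_degrees d f \<longleftrightarrow> (\<forall>m\<in>keys f. \<forall>v. lookup m v \<le> d)"

lemma ex_bounded_degrees:
  fixes f :: "('v::finite, 'k::zero) mpolynomial"
  shows "\<exists>d. bounded_degrees d f"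
proof -
  let ?D = "(\<lambda>(m, v). lookup m v) ` (keys f \<times> UNIV)"
  have "lookup m v \<le> Max ?D" if "m \<in> keys f" for m v
    using that by (intro Max_ge) (auto simp: rev_image_eqI)
  then show ?thesis
    unfolding bounded_degrees_def by blast
qed

lemma bounded_degrees_mono: "bounded_degrees d f \<Longrightarrow> d \<le> e \<Longrightarrow> bounded_degrees e f"
  unfolding bounded_degrees_def by (meson le_trans)

lemma bounded_degrees_one: "bounded_degrees 0 1"
  by (simp add: bounded_degrees_def)

lemma bounded_degrees_mult:
  assumes "bounded_degrees d f" "bounded_degrees e g"
  shows "bounded_degrees (d + e) (f * g)"
  unfolding bounded_degrees_def
proof (intro ballI allI)
  fix m v assume "m \<in> keys (f * g)"
  then obtain p q where "p \<in> keys f" "q \<in> keys g" "m = p + q"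
    using keys_mult by blast
  with assms show "lookup m v \<le> d + e"
    by (auto simp: bounded_degrees_def lookup_add intro!: add_mono)
qed

lemma bounded_degrees_power: "bounded_degrees d f \<Longrightarrow> bounded_degrees (n * d) (f ^ n)"
  by (induction n) (auto simp: bounded_degrees_one intro: bounded_degrees_mult)

lemma bounded_degrees_prod:
  "(\<And>i. i \<in> A \<Longrightarrow> bounded_degrees d (f i)) \<Longrightarrow> bounded_degrees (card A * d) (prod f A)"
  by (induction A rule: infinite_finite_induct)
    (auto simp: bounded_degrees_one intro: bounded_degrees_mult)

lemma bounded_degrees_span:
  obtains B :: "('v::finite, 'k::field) mpolynomial set"
  where "finite B" "card B \<le> Suc d ^ CARD('v)" "\<And>f. bounded_degrees d f \<Longrightarrow> f \<in> mpoly.span B"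
proof -
  let ?F = "UNIV \<rightarrow>\<^sub>E {..d} :: ('v \<Rightarrow> nat) set"
  let ?b = "\<lambda>e. single (Abs_poly_mapping e) (1 :: 'k)"
  have "f \<in> mpoly.span (?b ` ?F)" if f: "bounded_degrees d f" for f
  proof -
    have "single m (lookup f m) \<in> mpoly.span (?b ` ?F)" if "m \<in> keys f" for m
    proof -
      have "lookup m \<in> ?F"
        using f that by (auto simp: bounded_degrees_def)
      then have "?b (lookup m) \<in> ?b ` ?F"
        by (rule imageI)
      then have "const (lookup f m) * single m 1 \<in> mpoly.span (?b ` ?F)"
        by (intro mpoly.span_scale mpoly.span_base) simp
      then show ?thesis
        by (simp add: const_def mult_single)
    qed
    then have "(\<Sum>m\<in>keys f. single m (lookup f m)) \<in> mpoly.span (?b ` ?F)"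
      by (rule mpoly.span_sum)
    then show ?thesis
      by (simp flip: poly_mapping_expand)
  qed
  moreover have "finite ?F"
    by (auto intro: finite_PiE)
  moreover have "card ?F = Suc d ^ CARD('v)"
    by (simp add: card_PiE)
  ultimately show ?thesis
    using that[of "?b ` ?F"] card_image_le[of ?F ?b] by auto
qed

text \<open>By counting: for large \<open>N\<close> there are more power products with exponents at most \<open>N\<close> in \<open>s + 1\<close>
  polynomials than there are monomials in the \<open>s\<close> variables that can occur in them.\<close>

lemma algebraic_dependence:
  fixes x :: "nat \<Rightarrow> ('v::finite, 'k::field) mpolynomial"
  assumes n: "CARD('v) < n"
  obtains F c where "finite F" "F \<noteq> {}" "F \<subseteq> extensional {..<n}" "\<And>e. e \<in> F \<Longrightarrow> c e \<noteq> 0"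
    "(\<Sum>e\<in>F. const (c e) * (\<Prod>i<n. x i ^ e i)) = 0"
proof -
  define M where "M e = (\<Prod>i<n. x i ^ e i)" for e :: "nat \<Rightarrow> nat"
  have "\<forall>i. \<exists>d. bounded_degrees d (x i)"
    by (blast intro: ex_bounded_degrees)
  then obtain d' where d': "\<And>i. bounded_degrees (d' i) (x i)"
    unfolding choice_iff by blast
  define d where "d = Max (insert 0 (d' ` {..<n}))"
  have d: "bounded_degrees d (x i)" if "i < n" for i
    using d' by (rule bounded_degrees_mono) (use that in \<open>auto simp: d_def\<close>)
  \<comment> \<open>With s variables, the monomials number at most (C (N + 1))^s, and the choice N =
    C^s turns this into N (N + 1)^s < (N + 1)^(s + 1).\<close>
  define C where "C = n * d + 1"
  define N where "N = C ^ CARD('v)"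
  \<comment> \<open>Extensional functions represent each exponent tuple exactly once, so that
    \<open>A\<close> has (N + 1)^n elements.\<close>
  define A where "A = ({..<n} \<rightarrow>\<^sub>E {..N} :: (nat \<Rightarrow> nat) set)"
  have deg: "bounded_degrees (n * (N * d)) (M e)" if "e \<in> A" for e
  proof -
    have "bounded_degrees (N * d) (x i ^ e i)" if "i < n" for i
      using bounded_degrees_power[OF d[OF that], of "e i"]
      by (rule bounded_degrees_mono) (use \<open>e \<in> A\<close> that in \<open>auto simp: A_def PiE_iff\<close>)
    then show ?thesis
      using bounded_degrees_prod[of "{..<n}" "N * d" "\<lambda>i. x i ^ e i"] by (simp add: M_def)
  qed
  obtain B :: "('v, 'k) mpolynomial set" where B: "finite B"
    "card B \<le> Suc (n * (N * d)) ^ CARD('v)" "\<And>f. bounded_degrees (n * (N * d)) f \<Longrightarrow> f \<in> mpoly.span B"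
    using bounded_degrees_span[where d = "n * (N * d)" and 'v = 'v and 'k = 'k] by blast
  have "Suc (n * (N * d)) \<le> C * Suc N"
    by (simp add: C_def algebra_simps)
  then have "Suc (n * (N * d)) ^ CARD('v) \<le> (C * Suc N) ^ CARD('v)"
    by (rule power_mono) simp
  also have "\<dots> = N * Suc N ^ CARD('v)"
    by (simp only: power_mult_distrib N_def)
  also have "\<dots> < Suc N ^ Suc (CARD('v))"
    by simp
  also have "\<dots> \<le> Suc N ^ n"
    by (rule power_increasing) (use n in auto)
  also have "\<dots> = card A"
    by (simp add: A_def card_PiE)
  finally have "card B < card A"
    using B(2) by simp
  moreover have finA: "finite A"
    unfolding A_def by (auto intro: finite_PiE)
  moreover have "M ` A \<subseteq> mpoly.span B"
    using B(3) deg by blast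
  ultimately obtain c where c: "(\<Sum>e\<in>A. const (c e) * M e) = 0" "\<exists>e\<in>A. c e \<noteq> 0"
    using mpoly.dependent_family[of A B M] B(1) by blast
  let ?F = "{e \<in> A. c e \<noteq> 0}"
  have "(\<Sum>e\<in>?F. const (c e) * M e) = (\<Sum>e\<in>A. const (c e) * M e)"
    by (rule sum.mono_neutral_left) (use finA in \<open>auto simp: const_def\<close>)
  moreover have "A \<subseteq> extensional {..<n}"
    by (auto simp: A_def PiE_def)
  ultimately show ?thesis
    using c finA by (intro that[of ?F c]) (auto simp: M_def)
qed

text \<open>Given a chain of length \<open>s + 1\<close> and \<open>x i \<in> Q (i + 1) - Q i\<close>, an algebraic relation between
  the \<open>x i\<close> is stripped of one variable at each step of the chain: modulo \<open>Q (i + 1)\<close> only the terms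
  of lowest degree in \<open>x i\<close> survive. In the end a nonzero constant remains.\<close>

lemma prime_chain_length:
  fixes Q :: "nat \<Rightarrow> ('v::finite, 'k::field) mpolynomial set"
  assumes Q: "prime_chain type_ring Q n"
  shows "n \<le> CARD('v)"
proof (rule ccontr)
  assume "\<not> n \<le> CARD('v)"
  then have n: "CARD('v) < n" by simp
  have prime: "primeideal (Q i) type_ring" if "i \<le> n" for i
    using Q that by (simp add: prime_chain_def)
  have "\<exists>y. i < n \<longrightarrow> y \<in> Q (Suc i) - Q i" for i
    using Q by (auto simp: prime_chain_def)
  then obtain x where x: "\<And>i. i < n \<Longrightarrow> x i \<in> Q (Suc i) - Q i"
    by metis
  obtain F0 c where F0: "finite F0" "F0 \<noteq> {}" "F0 \<subseteq> extensional {..<n}" "\<And>e. e \<in> F0 \<Longrightarrow> c e \<noteq> 0"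
    "(\<Sum>e\<in>F0. const (c e) * (\<Prod>i<n. x i ^ e i)) = 0"
    using algebraic_dependence[OF n, of x] by blast
  \<comment> \<open>What is left of the term with exponents \<open>e\<close> once the powers of
    \<open>x 0\<close>, ..., \<open>x (k - 1)\<close> are stripped off.\<close>
  define Y where "Y k e = const (c e) * (\<Prod>i=k..<n. x i ^ e i)" for k e
  have "\<exists>F\<subseteq>F0. F \<noteq> {} \<and> (\<forall>e\<in>F. \<forall>e'\<in>F. \<forall>i<k. e i = e' i) \<and> sum (Y k) F \<in> Q k" if "k \<le> n" for k
    using that
  proof (induction k)
    case 0
    have "sum (Y 0) F0 \<in> Q 0"
      using F0(5) ideal_zero[OF primeideal_ideal[OF prime]] by (simp add: Y_def lessThan_atLeast0)
    then show ?case
      using F0(2) by blast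
  next
    case (Suc k)
    then obtain F where F: "F \<subseteq> F0" "F \<noteq> {}" "\<forall>e\<in>F. \<forall>e'\<in>F. \<forall>i<k. e i = e' i" "sum (Y k) F \<in> Q k"
      by auto
    note finF = finite_subset[OF F(1) F0(1)]
    \<comment> \<open>The common factor \<open>x k ^ m\<close> lies outside the prime
      \<open>Q k\<close> and can be cancelled. Terms with a larger exponent keep a factor
      \<open>x k\<close> from \<open>Q (Suc k)\<close>; their sum is \<open>r\<close>.\<close>
    define m where "m = Min ((\<lambda>e. e k) ` F)"
    have m_le: "m \<le> e k" if "e \<in> F" for e
      using finF that by (auto simp: m_def)
    have "m \<in> (\<lambda>e. e k) ` F"
      unfolding m_def using finF F(2) by (intro Min_in) auto
    define F' where "F' = {e \<in> F. e k = m}"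
    define r where "r = (\<Sum>e\<in>F - F'. x k ^ (e k - m) * Y (Suc k) e)"
    have k: "k < n" "k \<le> n" "Suc k \<le> n"
      using Suc.prems by auto
    have Y: "Y k e = x k ^ m * (x k ^ (e k - m) * Y (Suc k) e)" if "e \<in> F" for e
    proof -
      have "x k ^ e k = x k ^ m * x k ^ (e k - m)"
        using m_le[OF that] by (simp flip: power_add)
      then show ?thesis
        using k(1) by (simp add: Y_def prod.atLeast_Suc_lessThan ac_simps)
    qed
    have "sum (Y k) F = x k ^ m * (\<Sum>e\<in>F. x k ^ (e k - m) * Y (Suc k) e)"
      by (simp add: Y sum_distrib_left)
    also have "(\<Sum>e\<in>F. x k ^ (e k - m) * Y (Suc k) e) = r + (\<Sum>e\<in>F'. x k ^ (e k - m) * Y (Suc k) e)"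
      unfolding r_def by (rule sum.subset_diff) (use finF in \<open>auto simp: F'_def\<close>)
    also have "(\<Sum>e\<in>F'. x k ^ (e k - m) * Y (Suc k) e) = sum (Y (Suc k)) F'"
      by (rule sum.cong) (auto simp: F'_def)
    finally have "x k ^ m * (r + sum (Y (Suc k)) F') \<in> Q k"
      using F(4) by simp
    moreover have "x k ^ m \<notin> Q k"
      using primeideal_power[OF prime[OF k(2)]] x[OF k(1)] by blast
    ultimately have "r + sum (Y (Suc k)) F' \<in> Q k"
      using primeideal_mult[OF prime[OF k(2)]] by blast
    then have "r + sum (Y (Suc k)) F' \<in> Q (Suc k)"
      using Q k(1) unfolding prime_chain_def by blast
    moreover note I = primeideal_ideal[OF prime[OF k(3)]]
    have "r \<in> Q (Suc k)"
      unfolding r_def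
    proof (rule ideal_sum[OF I])
      fix e assume e: "e \<in> F - F'"
      then have "e k - m = Suc (e k - m - 1)"
        using m_le by (force simp: F'_def)
      then have "x k ^ (e k - m) = x k * x k ^ (e k - m - 1)"
        by (metis power_Suc)
      then show "x k ^ (e k - m) * Y (Suc k) e \<in> Q (Suc k)"
        using x[OF k(1)] by (auto intro: ideal_mult_right[OF I])
    qed
    ultimately have "sum (Y (Suc k)) F' \<in> Q (Suc k)"
      by (simp add: ideal_add_cancel[OF I])
    then show ?case
      using F \<open>m \<in> _\<close> by (intro exI[of _ F']) (auto simp: F'_def less_Suc_eq)
  qed
  from this[of n] obtain F where F: "F \<subseteq> F0" "F \<noteq> {}" "\<forall>e\<in>F. \<forall>e'\<in>F. \<forall>i<n. e i = e' i" "sum (Y n) F \<in> Q n"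
    by auto
  from F(2) obtain e where e: "e \<in> F" by blast
  \<comment> \<open>All exponents below \<open>n\<close> agree by the invariant, and all others by
    extensionality.\<close>
  have "e' = e" if "e' \<in> F" for e'
    by (rule extensionalityI[of _ "{..<n}"]) (use F that e F0(3) in auto)
  with e have "F = {e}" by blast
  then have "const (c e) \<in> Q n"
    using F(4) by (simp add: Y_def)
  then have "const (inverse (c e)) * const (c e) \<in> Q n"
    by (rule ideal_mult_left[OF primeideal_ideal[OF prime[OF order_refl]]])
  moreover have "c e \<noteq> 0"
    using F0(4) F(1) e by blast
  ultimately show False
    using primeideal_one[OF prime[OF order_refl]] by (simp add: const_def mult_single)
qed

section \<open>Monomials\<close>

abbreviation mono_of :: "('v \<Rightarrow>\<^sub>0 nat) \<Rightarrow> ('v, 'k::comm_ring_1) mpolynomial"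
  where "mono_of m \<equiv> single m 1"

lemma poly_mapping_nat_add_eq_0_iff:
  fixes p q :: "'v \<Rightarrow>\<^sub>0 nat"
  shows "p + q = 0 \<longleftrightarrow> p = 0 \<and> q = 0"
  by (auto simp: poly_mapping_eq_iff fun_eq_iff lookup_add)

lemma lookup_mult_single_add:
  fixes f :: "('v, 'k::comm_ring_1) mpolynomial"
  shows "lookup (f * single p c) (q + p) = lookup f q * c"
  by (induction f rule: poly_mapping_induct_add)
    (auto simp: mult_single lookup_single when_def lookup_add distrib_right)

lemma lookup_mult_single_not:
  fixes f :: "('v, 'k::comm_ring_1) mpolynomial"
  assumes "\<And>q. m \<noteq> q + p"
  shows "lookup (f * single p c) m = 0"
proof (induction f rule: poly_mapping_induct_add)
  case (monom q d)
  show ?case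
    using assms[of q] by (simp add: mult_single lookup_single when_def)
qed (simp add: lookup_add distrib_right)

lemma lookup_mult_zero:
  fixes f g :: "('v, 'k::comm_ring_1) mpolynomial"
  shows "lookup (f * g) 0 = lookup f 0 * lookup g 0"
proof (induction f rule: poly_mapping_induct_add)
  case (monom p c)
  show ?case
    by (induction g rule: poly_mapping_induct_add)
      (auto simp: mult_single lookup_single when_def lookup_add distrib_left
        poly_mapping_nat_add_eq_0_iff)
qed (simp add: lookup_add distrib_right)

lemma var_power: "(var i :: ('v, 'k::comm_ring_1) mpolynomial) ^ n = mono_of (single i n)"
  by (induction n) (simp_all add: var_def mult_single flip: single_add)

lemma monomial_eq:
  "(monomial c :: ('v::finite, 'k::comm_ring_1) mpolynomial) = mono_of (Abs_poly_mapping (($) c))"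
proof -
  have "(\<Prod>i\<in>A. mono_of (p i) :: ('v, 'k) mpolynomial) = mono_of (\<Sum>i\<in>A. p i)"
    for p :: "'v \<Rightarrow> 'v \<Rightarrow>\<^sub>0 nat" and A
    by (induction A rule: infinite_finite_induct) (simp_all add: mult_single)
  moreover have "(\<Sum>i\<in>UNIV. single i (c $ i)) = Abs_poly_mapping (($) c)"
    by (rule poly_mapping_eqI) (simp add: lookup_sum lookup_single when_def)
  ultimately show ?thesis
    by (simp add: monomial_def var_power)
qed

lemma mono_of_eq_monomial:
  "(mono_of m :: ('v::finite, 'k::comm_ring_1) mpolynomial) = monomial (\<chi> i. lookup m i)"
  unfolding monomial_eq by (rule arg_cong[of _ _ mono_of]) (auto intro: poly_mapping_eqI)

lemma primeideal_mono_of: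
  fixes P :: "('v::finite, 'k::comm_ring_1) mpolynomial set"
  assumes "primeideal P type_ring" "mono_of m \<in> P"
  shows "\<exists>i. 0 < lookup m i \<and> var i \<in> P"
proof -
  from assms obtain i where i: "var i ^ lookup m i \<in> P"
    by (auto simp: mono_of_eq_monomial monomial_def dest: primeideal_prod)
  then have "lookup m i \<noteq> 0"
    using primeideal_one[OF assms(1)] by (metis power_0)
  with i show ?thesis
    using primeideal_power[OF assms(1)] by blast
qed

lemma mono_of_in_ideal:
  fixes P :: "('v, 'k::comm_ring_1) mpolynomial set"
  assumes P: "ideal P type_ring" and "var i \<in> P" "0 < lookup m i"
  shows "single m c \<in> P"
proof -
  have "m = (m - single i 1) + single i 1"
    by (rule poly_mapping_eqI) (use assms(3) in \<open>auto simp: lookup_add lookup_minus lookup_single when_def\<close>)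
  then have "single m c = single (m - single i 1) c * var i"
    by (simp add: var_def mult_single)
  with assms show ?thesis
    by (simp add: ideal_mult_left)
qed

text \<open>Every monomial other than 1 is divisible by some variable.\<close>

lemma ideal_of_vars:
  fixes P :: "('v, 'k::comm_ring_1) mpolynomial set"
  assumes P: "ideal P type_ring" and "\<And>i. var i \<in> P" "lookup f 0 = 0"
  shows "f \<in> P"
proof -
  have "single m (lookup f m) \<in> P" if "m \<in> keys f" for m
  proof -
    have "m \<noteq> 0"
      using that assms(3) by (auto simp: in_keys_iff)
    then obtain i where "0 < lookup m i"
      by (auto simp: poly_mapping_eq_iff fun_eq_iff)
    with assms show ?thesis
      by (blast intro: mono_of_in_ideal)
  qed
  then have "(\<Sum>m\<in>keys f. single m (lookup f m)) \<in> P"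
    by (rule ideal_sum[OF P])
  then show ?thesis
    by (simp flip: poly_mapping_expand)
qed

definition total_degree :: "('v::finite \<Rightarrow>\<^sub>0 nat) \<Rightarrow> nat"
  where "total_degree m = (\<Sum>i\<in>UNIV. lookup m i)"

lemma total_degree_add: "total_degree (p + q) = total_degree p + total_degree q"
  by (simp add: total_degree_def lookup_add sum.distrib)

lemma total_degree_single [simp]: "total_degree (single i n) = n"
  by (simp add: total_degree_def lookup_single when_def)

lemma total_degree_eq_0_iff: "total_degree m = 0 \<longleftrightarrow> m = 0"
  by (auto simp: total_degree_def poly_mapping_eq_iff fun_eq_iff)

section \<open>The prime ideals of the origin and of the diagonal line\<close>

definition origin_ideal :: "('v, 'k::field) mpolynomial set"
  where "origin_ideal = {f. lookup f 0 = 0}"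

lemma primeideal_origin_ideal: "primeideal (origin_ideal :: ('v, 'k::field) mpolynomial set) type_ring"
  unfolding origin_ideal_def
  by (rule primeideal_kernel) (simp_all add: lookup_add lookup_mult_zero)

text \<open>This is evaluation at the point (1, ..., 1).\<close>

definition coeff_sum :: "('v, 'k::field) mpolynomial \<Rightarrow> 'k"
  where "coeff_sum f = (\<Sum>m. lookup f m)"

lemma coeff_sum_add: "coeff_sum (f + g) = coeff_sum f + coeff_sum g"
  by (simp add: coeff_sum_def lookup_add Sum_any.distrib)

lemma coeff_sum_diff: "coeff_sum (f - g) = coeff_sum f - coeff_sum g"
  using coeff_sum_add[of "f - g" g] by (simp add: eq_diff_eq)

lemma coeff_sum_single [simp]: "coeff_sum (single m c) = c"
  by (simp add: coeff_sum_def lookup_single)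

lemma coeff_sum_mult: "coeff_sum (f * g) = coeff_sum f * coeff_sum g"
proof (induction f rule: poly_mapping_induct_add)
  case (monom p c)
  show ?case
    by (induction g rule: poly_mapping_induct_add)
      (simp_all add: mult_single coeff_sum_add distrib_left)
qed (simp add: coeff_sum_add distrib_right)

text \<open>This is the kernel of substituting one indeterminate T for all variables: the
  coefficient of T^n in the image of \<open>f\<close> is the coefficient sum of its component of
  degree n. Written as a homogeneous core, it is prime by the general lemma.\<close>

definition diagonal_ideal :: "('v::finite, 'k::field) mpolynomial set"
  where "diagonal_ideal = homogeneous_core total_degree {f. coeff_sum f = 0}"

lemma primeideal_unit_point: "primeideal {f :: ('v, 'k::field) mpolynomial. coeff_sum f = 0} type_ring"
proof (rule primeideal_kernel)
  show "coeff_sum (1 :: ('v, 'k) mpolynomial) = 1"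
    using coeff_sum_single[of 0 "1 :: 'k"] by simp
qed (simp_all add: coeff_sum_add coeff_sum_mult)

lemma primeideal_diagonal_ideal:
  "primeideal (diagonal_ideal :: ('v::finite, 'k::field) mpolynomial set) type_ring"
  unfolding diagonal_ideal_def
  by (rule primeideal_homogeneous_core[where \<gamma> = total_degree, OF total_degree_add primeideal_unit_point])

lemma binomial_in_diagonal_ideal:
  assumes "total_degree p = total_degree q"
  shows "mono_of p - mono_of q \<in> (diagonal_ideal :: ('v::finite, 'k::field) mpolynomial set)"
proof -
  have "coeff_sum (mono_of p - mono_of q :: ('v, 'k) mpolynomial) = 0"
    by (simp add: coeff_sum_diff)
  moreover have "coeff_sum (0 :: ('v, 'k) mpolynomial) = 0"
    by (simp add: coeff_sum_def)
  ultimately show ?thesis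
    using assms by (simp add: diagonal_ideal_def homogeneous_core_def component_diff component_single)
qed

lemma var_notin_diagonal_ideal:
  "var i \<notin> (diagonal_ideal :: ('v::finite, 'k::field) mpolynomial set)"
proof
  assume "var i \<in> (diagonal_ideal :: ('v, 'k) mpolynomial set)"
  then have "var i \<in> {f :: ('v, 'k) mpolynomial. coeff_sum f = 0}"
    using homogeneous_core_subset[where \<gamma> = total_degree, OF total_degree_add primeideal_ideal[OF primeideal_unit_point]]
    unfolding diagonal_ideal_def by blast
  then show False
    by (simp add: var_def)
qed

lemma diagonal_ideal_subset_origin_ideal:
  "(diagonal_ideal :: ('v::finite, 'k::field) mpolynomial set) \<subseteq> origin_ideal"
proof
  fix f :: "('v, 'k) mpolynomial"
  assume "f \<in> diagonal_ideal"
  then have "coeff_sum (component total_degree 0 f) = 0"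
    by (simp add: diagonal_ideal_def homogeneous_core_def)
  moreover have "component total_degree 0 f = single 0 (lookup f 0)"
    by (rule poly_mapping_eqI)
      (auto simp: lookup_component lookup_single total_degree_eq_0_iff when_def)
  ultimately show "f \<in> origin_ideal"
    by (simp add: origin_ideal_def)
qed

lemma var_in_origin_ideal: "var i \<in> (origin_ideal :: ('v::finite, 'k::field) mpolynomial set)"
  by (simp add: origin_ideal_def var_def lookup_single when_def flip: total_degree_eq_0_iff)

text \<open>A chain ending in the diagonal prime can be prolonged by the origin prime, and the
  longer chain still has length at most s.\<close>

lemma prime_height_diagonal_ideal:
  "prime_height type_ring (diagonal_ideal :: ('v::finite, 'k::field) mpolynomial set)
    \<le> enat (CARD('v) - 1)"
proof (rule prime_height_le)
  fix Q and n :: nat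
  assume "prime_chain type_ring Q n" and n: "Q n = (diagonal_ideal :: ('v, 'k) mpolynomial set)"
  moreover have "Q n \<subset> origin_ideal"
    unfolding n using diagonal_ideal_subset_origin_ideal var_in_origin_ideal var_notin_diagonal_ideal
    by (metis psubsetI)
  ultimately have "prime_chain type_ring (Q(Suc n := origin_ideal)) (Suc n)"
    using primeideal_origin_ideal by (intro prime_chain_snoc)
  then have "Suc n \<le> CARD('v)"
    by (rule prime_chain_length)
  then show "n \<le> CARD('v) - 1" by simp
qed

section \<open>Binomials in a prime ideal that contains no variable\<close>

text \<open>Passing to the homogeneous core with respect to the degree in \<open>u\<close> removes exactly the
  binomial that involves \<open>u\<close>.\<close>

lemma prime_chain_of_binomials:
  fixes P :: "('v::finite, 'k::field) mpolynomial set"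
  assumes "finite A" "v \<notin> A" "primeideal P type_ring" "\<And>i. var i \<notin> P"
    and "\<And>u. u \<in> A \<Longrightarrow> \<exists>N>0. var u ^ N - var v ^ N \<in> P"
  shows "\<exists>Q. prime_chain type_ring Q (card A) \<and> Q (card A) = P"
  using assms
proof (induction A arbitrary: P rule: finite_induct)
  case empty
  then show ?case
    by (intro exI[of _ "\<lambda>_. P"]) (simp add: prime_chain_def)
next
  case (insert u A)
  let ?\<gamma> = "\<lambda>m :: 'v \<Rightarrow>\<^sub>0 nat. lookup m u"
  let ?P = "homogeneous_core ?\<gamma> P"
  have \<gamma>: "?\<gamma> (p + q) = ?\<gamma> p + ?\<gamma> q" for p q
    by (simp add: lookup_add)
  note P = insert.prems(2) and I = primeideal_ideal[OF insert.prems(2)]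
  have sub: "?P \<subseteq> P"
    by (rule homogeneous_core_subset[where \<gamma> = ?\<gamma>, OF \<gamma> I])
  \<comment> \<open>Neither variable of such a binomial is \<open>u\<close>, so it is homogeneous of
    degree 0 in \<open>u\<close> and survives in the core.\<close>
  have bin: "\<exists>N>0. var u' ^ N - var v ^ N \<in> ?P" if "u' \<in> A" for u'
  proof -
    obtain N where N: "N > 0" "var u' ^ N - var v ^ N \<in> P"
      using insert.prems(4) \<open>u' \<in> A\<close> by blast
    have "u' \<noteq> u" "v \<noteq> u"
      using insert \<open>u' \<in> A\<close> by auto
    with N show ?thesis
      by (intro exI[of _ N])
        (auto simp: homogeneous_core_def var_power component_diff component_single
          lookup_single when_def ideal_zero[OF I])
  qed
  have "var i \<notin> ?P" for i
    using sub insert.prems(3) by (rule contra_subsetD)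
  moreover have "v \<notin> A"
    using insert.prems(1) by simp
  ultimately have "\<exists>Q. prime_chain type_ring Q (card A) \<and> Q (card A) = ?P"
    using primeideal_homogeneous_core[where \<gamma> = ?\<gamma>, OF \<gamma> P] bin by (intro insert.IH)
  then obtain Q where Q: "prime_chain type_ring Q (card A)" "Q (card A) = ?P"
    by blast
  obtain N where N: "N > 0" "var u ^ N - var v ^ N \<in> P"
    using insert.prems(4) by blast
  \<comment> \<open>As \<open>N > 0\<close>, the two monomials have different degrees in
    \<open>u\<close>, so membership in the core would put \<open>var u ^ N\<close> into
    \<open>P\<close>.\<close>
  have "var u ^ N - var v ^ N \<notin> ?P"
  proof
    assume "var u ^ N - var v ^ N \<in> ?P"
    then have "component ?\<gamma> N (var u ^ N - var v ^ N) \<in> P"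
      by (simp add: homogeneous_core_def)
    moreover have "v \<noteq> u"
      using insert.prems(1) by auto
    ultimately have "var u ^ N \<in> P"
      using N(1) by (simp add: var_power component_diff component_single lookup_single when_def)
    then show False
      using primeideal_power[OF P] insert.prems(3) by blast
  qed
  then have "Q (card A) \<subset> P"
    using sub N(2) Q(2) by blast
  from prime_chain_snoc[OF Q(1) this P] show ?case
    using insert.hyps by (intro exI[of _ "Q(Suc (card A) := P)"]) (simp del: fun_upd_apply, simp)
qed

text \<open>The monomials of \<open>p\<close> and \<open>q\<close> may share a factor. This freedom
  makes the set closed under addition for every ideal \<open>P\<close>.\<close>

definition exponent_lattice :: "('v::finite, 'k::field) mpolynomial set \<Rightarrow> (int ^ 'v) set"
  where "exponent_lattice P =
    {a. \<exists>p q. (\<forall>i. a $ i = int (lookup p i) - int (lookup q i)) \<and> mono_of p - mono_of q \<in> P}"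

context
  fixes P :: "('v::finite, 'k::field) mpolynomial set"
  assumes P: "ideal P type_ring"
begin

lemma exponent_lattice_zero: "0 \<in> exponent_lattice P"
  unfolding exponent_lattice_def by (auto intro!: exI[of _ 0] simp: ideal_zero[OF P])

lemma exponent_lattice_add:
  assumes "a \<in> exponent_lattice P" "b \<in> exponent_lattice P"
  shows "a + b \<in> exponent_lattice P"
proof -
  obtain p q where a: "\<forall>i. a $ i = int (lookup p i) - int (lookup q i)" "mono_of p - mono_of q \<in> P"
    using assms(1) by (auto simp: exponent_lattice_def)
  obtain p' q' where b: "\<forall>i. b $ i = int (lookup p' i) - int (lookup q' i)" "mono_of p' - mono_of q' \<in> P"
    using assms(2) by (auto simp: exponent_lattice_def)
  \<comment> \<open>The middle terms cancel, leaving the binomial of the summed exponents.\<close>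
  have "mono_of p' * (mono_of p - mono_of q) + mono_of q * (mono_of p' - mono_of q') \<in> P"
    by (intro ideal_add[OF P] ideal_mult_left[OF P] a b)
  also have "mono_of p' * (mono_of p - mono_of q) + mono_of q * (mono_of p' - mono_of q')
      = (mono_of (p + p') - mono_of (q + q') :: ('v, 'k) mpolynomial)"
    by (simp add: right_diff_distrib mult_single ac_simps)
  finally show ?thesis
    using a(1) b(1) unfolding exponent_lattice_def mem_Collect_eq
    by (intro exI[of _ "p + p'"] exI[of _ "q + q'"]) (simp add: lookup_add)
qed

lemma exponent_lattice_uminus:
  assumes "a \<in> exponent_lattice P"
  shows "- a \<in> exponent_lattice P"
proof -
  obtain p q where a: "\<forall>i. a $ i = int (lookup p i) - int (lookup q i)" "mono_of p - mono_of q \<in> P"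
    using assms by (auto simp: exponent_lattice_def)
  have "mono_of q - mono_of p \<in> P"
    using ideal_diff[OF P ideal_zero[OF P] a(2)] by simp
  with a(1) show ?thesis
    unfolding exponent_lattice_def mem_Collect_eq
    by (intro exI[of _ q] exI[of _ p]) simp
qed

lemma exponent_lattice_scale:
  assumes "a \<in> exponent_lattice P"
  shows "k *s a \<in> exponent_lattice P"
proof -
  have nat: "int n *s a \<in> exponent_lattice P" for n
    by (induction n)
      (auto simp: vector_sadd_rdistrib intro: exponent_lattice_zero exponent_lattice_add assms)
  show ?thesis
  proof (cases "k \<ge> 0")
    case True
    then show ?thesis using nat[of "nat k"] by simp
  next
    case False
    then have "k *s a = - (int (nat (- k)) *s a)"
      by (simp add: vec_eq_iff)
    then show ?thesis
      using exponent_lattice_uminus[OF nat] by metis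
  qed
qed

lemma exponent_lattice_sum:
  "(\<And>x. x \<in> A \<Longrightarrow> a x \<in> exponent_lattice P) \<Longrightarrow> sum a A \<in> exponent_lattice P"
  by (induction A rule: infinite_finite_induct)
    (auto intro: exponent_lattice_zero exponent_lattice_add)

end

text \<open>A binomial in \<open>P\<close> with this exponent difference is a monomial times the
  desired one. A prime without variables contains no monomial, so the common factor cancels.\<close>

lemma var_power_diff_in_prime:
  fixes P :: "('v::finite, 'k::field) mpolynomial set"
  assumes P: "primeideal P type_ring" and vars: "\<And>i. var i \<notin> P"
    and a: "(\<chi> i. int N * ((if i = u then 1 else 0) - (if i = v then 1 else 0))) \<in> exponent_lattice P"
    and "u \<noteq> v"
  shows "var u ^ N - var v ^ N \<in> P"
proof -
  obtain p q where pq: "\<And>i. int N * ((if i = u then 1 else 0) - (if i = v then 1 else 0))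
        = int (lookup p i) - int (lookup q i)"
    and P': "mono_of p - mono_of q \<in> P"
    using a by (auto simp: exponent_lattice_def)
  let ?r = "p - single u N"
  have u: "lookup p u = lookup q u + N" and v: "lookup q v = lookup p v + N"
    using pq[of u] pq[of v] \<open>u \<noteq> v\<close> by auto
  have i: "lookup p i = lookup q i" if "i \<noteq> u" "i \<noteq> v" for i
    using pq[of i] that by simp
  have p: "p = ?r + single u N"
    by (rule poly_mapping_eqI) (use u in \<open>auto simp: lookup_add lookup_minus lookup_single when_def\<close>)
  have q: "q = ?r + single v N"
  proof (rule poly_mapping_eqI)
    fix k show "lookup q k = lookup (?r + single v N) k"
      using u v i[of k] \<open>u \<noteq> v\<close> by (cases "k = u"; cases "k = v")
        (auto simp: lookup_add lookup_minus lookup_single when_def)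
  qed
  have "mono_of ?r * (var u ^ N - var v ^ N) = (mono_of p - mono_of q :: ('v, 'k) mpolynomial)"
    by (subst (2) p, subst q) (simp add: var_power right_diff_distrib mult_single)
  then have "mono_of ?r * (var u ^ N - var v ^ N) \<in> P"
    using P' by simp
  moreover have "mono_of ?r \<notin> P"
    using primeideal_mono_of[OF P] vars by blast
  ultimately show ?thesis
    using primeideal_mult[OF P] by blast
qed

section \<open>The Laplacian matrix\<close>

text \<open>This turns a rational solution of a Laplacian system into an integral one.\<close>

lemma common_denominator:
  fixes x :: "'a \<Rightarrow> rat"
  assumes "finite A"
  shows "\<exists>N>0. \<forall>a\<in>A. of_nat N * x a \<in> \<int>"
  using assms
proof (induction A rule: finite_induct)
  case empty
  show ?case by (intro exI[of _ 1]) simp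
next
  case (insert b A)
  then obtain N where N: "N > 0" "\<And>a. a \<in> A \<Longrightarrow> of_nat N * x a \<in> \<int>"
    by auto
  obtain p q where q: "q > 0" "x b = of_int p / of_int q"
    by (metis quotient_of_denom_pos quotient_of_div surj_pair)
  then have "of_nat (nat q) * x b = of_int p"
    by simp
  then have b: "of_nat (nat q) * x b \<in> \<int>"
    by simp
  have "of_nat (N * nat q) * x a \<in> \<int>" if "a \<in> insert b A" for a
  proof (cases "a = b")
    case True
    have "of_nat (N * nat q) * x b = of_nat N * (of_nat (nat q) * x b)"
      by simp
    also have "\<dots> \<in> \<int>"
      by (rule Ints_mult[OF _ b]) simp
    finally show ?thesis using True by simp
  next
    case False
    have "of_nat (N * nat q) * x a = of_nat (nat q) * (of_nat N * x a)"
      by simp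
    also have "\<dots> \<in> \<int>"
      by (rule Ints_mult) (use that N(2) False in auto)
    finally show ?thesis .
  qed
  then show ?case
    using N(1) q(1) by (intro exI[of _ "N * nat q"]) auto
qed

context connected_weighted_graph
begin

abbreviation L :: "int ^ 'v ^ 'v"
  where "L \<equiv> laplacian_matrix E w"

definition neighbours :: "'v \<Rightarrow> 'v set"
  where "neighbours i = {j. {i, j} \<in> E}"

definition weighted_degree :: "'v \<Rightarrow> nat"
  where "weighted_degree i = (\<Sum>e\<in>incident_edges E i. w e)"

definition neighbour_exponent :: "'v \<Rightarrow> 'v \<Rightarrow>\<^sub>0 nat"
  where "neighbour_exponent i = Abs_poly_mapping (\<lambda>j. if {i, j} \<in> E then w {i, j} else 0)"

lemma lookup_neighbour_exponent:
  "lookup (neighbour_exponent i) j = (if {i, j} \<in> E then w {i, j} else 0)"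
  by (simp add: neighbour_exponent_def)

lemma no_loop: "{i, i} \<notin> E"
  using simple[of "{i, i}"] by auto

lemma bij_betw_neighbours: "bij_betw (\<lambda>j. {i, j}) (neighbours i) (incident_edges E i)"
proof -
  have "\<exists>j. e = {i, j}" if "e \<in> E" "i \<in> e" for e
    using simple[OF that(1)] that(2) by (auto simp: card_2_iff)
  moreover have "inj_on (\<lambda>j. {i, j}) (neighbours i)"
    by (auto simp: inj_on_def doubleton_eq_iff)
  ultimately show ?thesis
    by (fastforce simp: bij_betw_def incident_edges_def neighbours_def)
qed

text \<open>Edges at \<open>i\<close> correspond to neighbours of \<open>i\<close>. The equality
  makes the Laplacian binomials homogeneous and the row sums of \<open>L\<close> zero.\<close>

lemma weighted_degree_eq: "weighted_degree i = total_degree (neighbour_exponent i)"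
proof -
  have "weighted_degree i = (\<Sum>j\<in>neighbours i. w {i, j})"
    unfolding weighted_degree_def by (rule sum.reindex_bij_betw[OF bij_betw_neighbours, symmetric])
  also have "\<dots> = (\<Sum>j\<in>UNIV. if {i, j} \<in> E then w {i, j} else 0)"
    by (simp add: neighbours_def flip: sum.inter_filter)
  finally show ?thesis
    by (simp add: total_degree_def lookup_neighbour_exponent)
qed

lemma laplacian_matrix_nth: "L $ i $ j =
    int (lookup (single i (weighted_degree i)) j) - int (lookup (neighbour_exponent i) j)"
  using no_loop
  by (auto simp: laplacian_matrix_def weighted_degree_def lookup_single when_def
      lookup_neighbour_exponent)

lemma laplacian_matrix_sym: "L $ i $ j = L $ j $ i"
  by (auto simp: laplacian_matrix_def insert_commute)

lemma laplacian_matrix_row_sum: "(\<Sum>j\<in>UNIV. L $ i $ j) = 0"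
proof -
  have "(\<Sum>j\<in>UNIV. L $ i $ j) =
      int (total_degree (single i (weighted_degree i))) - int (total_degree (neighbour_exponent i))"
    by (simp only: laplacian_matrix_nth sum_subtractf total_degree_def of_nat_sum)
  then show ?thesis
    by (simp add: weighted_degree_eq)
qed

lemma connected_induct [consumes 1, case_names step]:
  assumes "Q i" "\<And>i j. {i, j} \<in> E \<Longrightarrow> Q i \<Longrightarrow> Q j"
  shows "Q j"
  using connected[of i j]
  by (induction rule: rtrancl_induct) (use assms in auto)

text \<open>Maximum principle: being a maximum of \<open>x\<close> spreads to all neighbours of a vertex.\<close>

lemma laplacian_kernel:
  fixes x :: "'v \<Rightarrow> rat"
  assumes "\<And>i. (\<Sum>j\<in>UNIV. of_int (L $ i $ j) * x j) = 0"
  shows "x i = x j"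
proof -
  define m where "m = Max (range x)"
  have le: "x k \<le> m" for k
    by (simp add: m_def)
  have "m \<in> range x"
    unfolding m_def by (rule Max_in) auto
  then obtain i0 where "x i0 = m" by auto
  then have "x k = m" for k
  proof (induction k rule: connected_induct)
    case (step i j)
    have "(\<Sum>k\<in>UNIV. of_int (L $ i $ k) * (x k - m))
        = (\<Sum>k\<in>UNIV. of_int (L $ i $ k) * x k) - of_int (\<Sum>k\<in>UNIV. L $ i $ k) * m"
      by (simp add: right_diff_distrib sum_subtractf sum_distrib_right)
    then have sum0: "(\<Sum>k\<in>UNIV. of_int (L $ i $ k) * (x k - m)) = 0"
      by (simp add: assms laplacian_matrix_row_sum)
    \<comment> \<open>The diagonal term vanishes and the others are products of nonpositive factors.
      As the sum is 0, each term is 0.\<close>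
    have "of_int (L $ i $ k) * (x k - m) \<ge> 0" for k
    proof (cases "k = i")
      case True
      then show ?thesis using step.IH by simp
    next
      case False
      then have "L $ i $ k \<le> 0"
        by (simp add: laplacian_matrix_def)
      then show ?thesis
        using le[of k] by (intro mult_nonpos_nonpos) auto
    qed
    with sum0 have "of_int (L $ i $ j) * (x j - m) = 0"
      by (subst (asm) sum_nonneg_eq_0_iff) auto
    moreover have "L $ i $ j \<noteq> 0"
      using step.hyps no_loop positive_weight[of "{i, j}"] by (auto simp: laplacian_matrix_def)
    ultimately show ?case by simp
  qed
  then show ?thesis by simp
qed

text \<open>Adding the all-ones matrix makes the Laplacian matrix invertible over \<open>\<rat>\<close>.\<close>

lemma laplacian_image:
  obtains N y where "N > 0"
    "\<And>i. (\<Sum>j\<in>UNIV. L $ i $ j * y j) = int N * ((if i = u then 1 else 0) - (if i = v then 1 else 0))"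
proof -
  define A :: "rat ^ 'v ^ 'v" where "A = (\<chi> i j. of_int (L $ i $ j) + 1)"
  have A: "(A *v x) $ i = (\<Sum>j\<in>UNIV. of_int (L $ i $ j) * x $ j) + (\<Sum>j\<in>UNIV. x $ j)" for x i
    by (simp add: A_def matrix_vector_mult_def distrib_right sum.distrib)
  \<comment> \<open>By symmetry the columns of \<open>L\<close> also sum to 0, so the coordinates of
    \<open>A *v x\<close> add up to s times the coordinate sum of \<open>x\<close>.\<close>
  have col: "(\<Sum>i\<in>UNIV. \<Sum>j\<in>UNIV. of_int (L $ i $ j) * x $ j) = 0" for x :: "rat ^ 'v"
  proof -
    have "(\<Sum>i\<in>UNIV. \<Sum>j\<in>UNIV. of_int (L $ i $ j) * x $ j)
        = (\<Sum>j\<in>UNIV. \<Sum>i\<in>UNIV. of_int (L $ j $ i) * x $ j)"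
      by (subst sum.swap, intro sum.cong refl, subst laplacian_matrix_sym) (rule refl)
    also have "\<dots> = (\<Sum>j\<in>UNIV. of_int (\<Sum>i\<in>UNIV. L $ j $ i) * x $ j)"
      by (simp add: sum_distrib_right)
    finally show ?thesis
      by (simp only: laplacian_matrix_row_sum of_int_0 mult_zero_left sum.neutral_const)
  qed
  have sum_zero: "(\<Sum>j\<in>UNIV. x $ j) = 0" if "(\<Sum>i\<in>UNIV. (A *v x) $ i) = 0" for x :: "rat ^ 'v"
    using that by (simp add: A sum.distrib col)
  have "x = 0" if "A *v x = 0" for x
  proof -
    have s: "(\<Sum>j\<in>UNIV. x $ j) = 0"
      by (rule sum_zero) (simp add: that)
    then have "(\<Sum>j\<in>UNIV. of_int (L $ i $ j) * x $ j) = 0" for i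
      using A[of x i] that by simp
    then have const: "x $ i = x $ j" for i j
      by (rule laplacian_kernel)
    have "x $ i = 0" for i
    proof -
      have "(\<Sum>j\<in>UNIV. x $ j) = (\<Sum>j\<in>(UNIV :: 'v set). x $ i)"
        by (rule sum.cong[OF refl const])
      with s show ?thesis by simp
    qed
    then show ?thesis by (simp add: vec_eq_iff)
  qed
  then have "\<exists>B. B ** A = mat 1"
    by (simp add: matrix_left_invertible_ker)
  then have "surj (\<lambda>x. A *v x)"
    unfolding matrix_right_invertible_surjective[symmetric] using matrix_left_right_inverse by blast
  then have "\<exists>x. (\<chi> i. (if i = u then 1 else 0) - (if i = v then 1 else 0)) = A *v x"
    by (rule surjD)
  then obtain x where x: "A *v x = (\<chi> i. (if i = u then 1 else 0) - (if i = v then 1 else 0))"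
    by auto
  \<comment> \<open>The right-hand side has coordinate sum 0, hence so has \<open>x\<close>, and on
    such vectors \<open>A\<close> acts as \<open>L\<close>.\<close>
  have s: "(\<Sum>j\<in>UNIV. x $ j) = 0"
    by (rule sum_zero) (simp add: x sum_subtractf)
  obtain N where N: "N > 0" "\<And>j. of_nat N * x $ j \<in> \<int>"
    using common_denominator[of UNIV "\<lambda>j. x $ j"] by auto
  then have "\<forall>j. \<exists>z. of_nat N * x $ j = of_int z"
    by (auto elim: Ints_cases)
  then have "\<exists>y. \<forall>j. of_nat N * x $ j = of_int (y j)"
    by (rule choice)
  then obtain y where y: "\<And>j. of_int (y j) = of_nat N * x $ j"
    by auto
  have "(\<Sum>j\<in>UNIV. L $ i $ j * y j) = int N * ((if i = u then 1 else 0) - (if i = v then 1 else 0))" for i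
  proof -
    have "(of_int (\<Sum>j\<in>UNIV. L $ i $ j * y j) :: rat) = of_nat N * (\<Sum>j\<in>UNIV. of_int (L $ i $ j) * x $ j)"
      by (simp add: y sum_distrib_left ac_simps)
    also have "(\<Sum>j\<in>UNIV. of_int (L $ i $ j) * x $ j) = (A *v x) $ i"
      by (simp add: A s)
    also have "of_nat N * (A *v x) $ i
        = of_int (int N * ((if i = u then 1 else 0) - (if i = v then 1 else 0)))"
      by (simp add: x)
    finally show ?thesis
      by (simp only: of_int_eq_iff)
  qed
  with N(1) show ?thesis
    by (rule that)
qed

section \<open>The Laplacian ideal\<close>

definition laplacian_binomial :: "'v \<Rightarrow> ('v, 'k::field) mpolynomial"
  where "laplacian_binomial i =
    mono_of (single i (weighted_degree i)) - mono_of (neighbour_exponent i)"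

text \<open>Without loops, the pure power and the neighbour monomial of a vertex have disjoint
  supports, so they are the positive and negative part of the column.\<close>

lemma laplacian_ideal_eq:
  "(laplacian_ideal E w :: ('v, 'k::field) mpolynomial set)
    = genideal type_ring (range laplacian_binomial)"
proof -
  have column: "column i L $ j =
      int (lookup (single i (weighted_degree i)) j) - int (lookup (neighbour_exponent i) j)" for i j
    using laplacian_matrix_sym[of j i] by (simp add: column_def laplacian_matrix_nth)
  have disjoint: "lookup (single i n) j = 0 \<or> lookup (neighbour_exponent i) j = 0" for i j n
    using no_loop by (simp add: lookup_single when_def lookup_neighbour_exponent)
  have "pos_part (column i L) $ j = lookup (single i (weighted_degree i)) j"
    "neg_part (column i L) $ j = lookup (neighbour_exponent i) j" for i j
    using disjoint[of i "weighted_degree i" j] by (auto simp: pos_part_def neg_part_def column)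
  then have "Abs_poly_mapping (($) (pos_part (column i L))) = single i (weighted_degree i)"
    "Abs_poly_mapping (($) (neg_part (column i L))) = neighbour_exponent i" for i
    by (auto intro: poly_mapping_eqI)
  then have "monomial (pos_part (column i L)) - monomial (neg_part (column i L))
      = (laplacian_binomial i :: ('v, 'k) mpolynomial)" for i
    by (simp add: monomial_eq laplacian_binomial_def)
  moreover have "columns L = range (\<lambda>i. column i L)"
    by (auto simp: columns_def)
  ultimately show ?thesis
    by (simp add: laplacian_ideal_def polynomial_ring_def image_image)
qed

lemma ideal_laplacian_ideal: "ideal (laplacian_ideal E w :: ('v, 'k::field) mpolynomial set) type_ring"
  unfolding laplacian_ideal_eq
  by (rule ring.genideal_ideal[OF ring_from_type_algebra]) simp

lemma laplacian_binomial_in_ideal: "laplacian_binomial i \<in> laplacian_ideal E w"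
  using ring.genideal_self[OF ring_from_type_algebra, of "range laplacian_binomial"]
  by (auto simp: laplacian_ideal_eq)

lemma laplacian_ideal_subset_iff:
  fixes J :: "('v, 'k::field) mpolynomial set"
  assumes "ideal J type_ring"
  shows "laplacian_ideal E w \<subseteq> J \<longleftrightarrow> (\<forall>i. laplacian_binomial i \<in> J)"
  using ring.Idl_subset_ideal[OF ring_from_type_algebra assms, of "range laplacian_binomial"]
  by (auto simp: laplacian_ideal_eq)

section \<open>The height of the Laplacian ideal\<close>

lemma laplacian_ideal_subset_diagonal_ideal:
  "laplacian_ideal E w \<subseteq> (diagonal_ideal :: ('v, 'k::field) mpolynomial set)"
  by (simp add: laplacian_ideal_subset_iff[OF primeideal_ideal[OF primeideal_diagonal_ideal]]
      laplacian_binomial_def binomial_in_diagonal_ideal weighted_degree_eq)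

context
  fixes P :: "('v, 'k::field) mpolynomial set"
  assumes P: "primeideal P type_ring" and sub: "laplacian_ideal E w \<subseteq> P"
begin

text \<open>If \<open>i\<close> is adjacent to \<open>j\<close>, then \<open>var i\<close> divides
  the neighbour monomial of \<open>j\<close>; the binomial of \<open>j\<close> then puts a power of
  \<open>var j\<close> into \<open>P\<close>.\<close>

lemma vars_in_prime:
  assumes "var i \<in> P"
  shows "var j \<in> P"
  using assms
proof (induction j rule: connected_induct)
  case (step i j)
  then have "mono_of (neighbour_exponent j) \<in> P"
    using positive_weight
    by (intro mono_of_in_ideal[OF primeideal_ideal[OF P], of i])
      (auto simp: lookup_neighbour_exponent insert_commute)
  moreover have "laplacian_binomial j \<in> P"
    using sub laplacian_binomial_in_ideal by blast
  ultimately have "laplacian_binomial j + mono_of (neighbour_exponent j) \<in> P"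
    by (intro ideal_add[OF primeideal_ideal[OF P]])
  then have "var j ^ weighted_degree j \<in> P"
    by (simp add: laplacian_binomial_def var_power)
  then show ?case
    by (rule primeideal_power[OF P])
qed

text \<open>The columns of \<open>L\<close> lie in the exponent lattice of \<open>P\<close>, and
  some positive multiple of the difference of two unit vectors is an integral combination of
  them.\<close>

lemma var_power_diff_in_prime_above:
  assumes "\<And>i. var i \<notin> P" "u \<noteq> v"
  shows "\<exists>N>0. var u ^ N - var v ^ N \<in> P"
proof -
  obtain N y where N: "N > 0" and y:
    "\<And>i. (\<Sum>j\<in>UNIV. L $ i $ j * y j) = int N * ((if i = u then 1 else 0) - (if i = v then 1 else 0))"
    using laplacian_image[of u v] by blast
  have "column j L \<in> exponent_lattice P" for j
  proof -
    have "mono_of (single j (weighted_degree j)) - mono_of (neighbour_exponent j) \<in> P"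
      using sub laplacian_binomial_in_ideal[of j] by (auto simp: laplacian_binomial_def)
    then show ?thesis
      unfolding exponent_lattice_def mem_Collect_eq
      by (intro exI conjI allI)
        (auto simp: column_def laplacian_matrix_sym[of _ j] laplacian_matrix_nth[of j])
  qed
  then have "(\<Sum>j\<in>UNIV. y j *s column j L) \<in> exponent_lattice P"
    using primeideal_ideal[OF P] by (intro exponent_lattice_sum exponent_lattice_scale) auto
  also have "(\<Sum>j\<in>UNIV. y j *s column j L)
      = (\<chi> i. int N * ((if i = u then 1 else 0) - (if i = v then 1 else 0)))"
    by (simp add: vec_eq_iff column_def mult.commute flip: y)
  finally show ?thesis
    using N var_power_diff_in_prime[OF P assms(1) _ assms(2)] by blast
qed

end

lemma prime_chain_above_laplacian_ideal:
  fixes P :: "('v, 'k::field) mpolynomial set"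
  assumes P: "primeideal P type_ring" and "laplacian_ideal E w \<subseteq> P" and vars: "\<And>i. var i \<notin> P"
  shows "\<exists>Q. prime_chain type_ring Q (CARD('v) - 1) \<and> Q (CARD('v) - 1) = P"
proof -
  fix v :: 'v
  have "\<exists>Q. prime_chain type_ring Q (card (UNIV - {v})) \<and> Q (card (UNIV - {v})) = P"
    using P vars var_power_diff_in_prime_above[OF assms]
    by (intro prime_chain_of_binomials) auto
  then show ?thesis
    by (simp add: card_Diff_singleton)
qed

lemma ideal_height_laplacian_ideal:
  "ideal_height type_ring (laplacian_ideal E w :: ('v, 'k::field) mpolynomial set)
    = enat (CARD('v) - 1)"
proof (rule antisym)
  have "ideal_height type_ring (laplacian_ideal E w :: ('v, 'k) mpolynomial set)
      \<le> prime_height type_ring (diagonal_ideal :: ('v, 'k) mpolynomial set)"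
    unfolding ideal_height_def
    by (rule INF_lower) (simp add: primeideal_diagonal_ideal laplacian_ideal_subset_diagonal_ideal)
  also have "\<dots> \<le> enat (CARD('v) - 1)"
    by (rule prime_height_diagonal_ideal)
  finally show "ideal_height type_ring (laplacian_ideal E w :: ('v, 'k) mpolynomial set)
      \<le> enat (CARD('v) - 1)" .
next
  have "enat (CARD('v) - 1) \<le> prime_height type_ring P"
    if P: "primeideal P type_ring" "laplacian_ideal E w \<subseteq> P"
    for P :: "('v, 'k) mpolynomial set"
  proof (cases "\<exists>i. var i \<in> P")
    case False
    then have vars: "var i \<notin> P" for i
      by simp
    obtain Q where "prime_chain type_ring Q (CARD('v) - 1)" "Q (CARD('v) - 1) = P"
      using prime_chain_above_laplacian_ideal[OF P vars] by auto
    then show ?thesis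
      using prime_chain_le_height[of type_ring Q "CARD('v) - 1"] by simp
  next
    case True
    then have vars: "var i \<in> P" for i
      using vars_in_prime[OF P] by blast
    \<comment> \<open>Now \<open>P\<close> contains the origin prime and lies strictly above the
      diagonal prime. The latter contains no variable, so it ends a chain of length s - 1, to which
      \<open>P\<close> can be appended.\<close>
    have "diagonal_ideal \<subseteq> P"
      using diagonal_ideal_subset_origin_ideal ideal_of_vars[OF primeideal_ideal[OF P(1)] vars]
      by (fastforce simp: origin_ideal_def)
    then have less: "diagonal_ideal \<subset> P"
      using vars var_notin_diagonal_ideal by blast
    obtain Q where Q: "prime_chain type_ring Q (CARD('v) - 1)"
      "Q (CARD('v) - 1) = (diagonal_ideal :: ('v, 'k) mpolynomial set)"
      using prime_chain_above_laplacian_ideal[OF primeideal_diagonal_ideal laplacian_ideal_subset_diagonal_ideal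
          var_notin_diagonal_ideal] by auto
    have "enat (CARD('v) - 1) \<le> enat (Suc (CARD('v) - 1))"
      by simp
    also have "\<dots> \<le> prime_height type_ring P"
      using prime_chain_le_height[OF prime_chain_snoc[OF Q(1) _ P(1)]] less Q(2) by simp
    finally show ?thesis .
  qed
  then show "enat (CARD('v) - 1)
      \<le> ideal_height type_ring (laplacian_ideal E w :: ('v, 'k) mpolynomial set)"
    unfolding ideal_height_def by (intro INF_greatest) auto
qed

section \<open>The minimal number of generators\<close>

text \<open>On the Laplacian ideal \<open>I\<close> this map factors through \<open>I / MI\<close>, where \<open>M\<close> is the ideal of the
  origin. If every vertex has at least two neighbours, then the pure powers occur in no multiple of
  another binomial.\<close>

definition pure_power_coeffs :: "('v, 'k::field) mpolynomial \<Rightarrow> 'k ^ 'v"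
  where "pure_power_coeffs f = (\<chi> i. lookup f (single i (weighted_degree i)))"

lemma pure_power_coeffs_add: "pure_power_coeffs (f + g) = pure_power_coeffs f + pure_power_coeffs g"
  by (simp add: pure_power_coeffs_def lookup_add vec_eq_iff)

lemma pure_power_coeffs_zero: "pure_power_coeffs 0 = 0"
  by (simp add: pure_power_coeffs_def vec_eq_iff)

context
  assumes two_edges: "\<And>i. card (incident_edges E i) \<ge> 2"
begin

lemma two_neighbours: "\<exists>a b. a \<noteq> b \<and> {i, a} \<in> E \<and> {i, b} \<in> E"
proof -
  have "card (neighbours i) \<ge> 2"
    using two_edges[of i] bij_betw_same_card[OF bij_betw_neighbours] by simp
  then obtain T where "T \<subseteq> neighbours i" "card T = 2"
    by (meson obtain_subset_with_card_n)
  then show ?thesis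
    by (auto simp: card_2_iff neighbours_def)
qed

lemma weighted_degree_pos: "weighted_degree i > 0"
proof -
  obtain a where a: "{i, a} \<in> E"
    using two_neighbours[of i] by blast
  then have "lookup (neighbour_exponent i) a > 0"
    using positive_weight by (simp add: lookup_neighbour_exponent)
  then have "neighbour_exponent i \<noteq> 0"
    by auto
  then show ?thesis
    by (simp add: weighted_degree_eq total_degree_eq_0_iff flip: neq0_conv)
qed

lemma pure_power_coeffs_mult_binomial:
  fixes g :: "('v, 'k::field) mpolynomial"
  shows "pure_power_coeffs (g * laplacian_binomial i) = axis i (lookup g 0)"
proof -
  have "lookup (g * mono_of (single i (weighted_degree i))) (single j (weighted_degree j))
      = (if j = i then lookup g 0 else 0)" for j
  proof (cases "j = i")
    case True
    then show ?thesis
      using lookup_mult_single_add[of g "single i (weighted_degree i)" 1 0] by simp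
  next
    case False
    have "single j (weighted_degree j) \<noteq> q + single i (weighted_degree i)" for q
    proof
      assume "single j (weighted_degree j) = q + single i (weighted_degree i)"
      then have "lookup (single j (weighted_degree j)) i
          = lookup (q + single i (weighted_degree i)) i"
        by simp
      then show False
        using False weighted_degree_pos[of i] by (simp add: lookup_add lookup_single when_def)
    qed
    then show ?thesis
      using False by (simp add: lookup_mult_single_not)
  qed
  moreover have "lookup (g * mono_of (neighbour_exponent i)) (single j n) = 0" for j n
  proof (rule lookup_mult_single_not)
    \<comment> \<open>Of the two neighbours of \<open>i\<close>, at least one differs from
      \<open>j\<close>; its variable divides the neighbour monomial but no power of
      \<open>var j\<close>.\<close>
    obtain a where a: "{i, a} \<in> E" "a \<noteq> j"
      using two_neighbours[of i] by metis
    fix q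
    show "single j n \<noteq> q + neighbour_exponent i"
    proof
      assume "single j n = q + neighbour_exponent i"
      then have "lookup (single j n) a = lookup (q + neighbour_exponent i) a"
        by simp
      then show False
        using a positive_weight[of "{i, a}"]
        by (simp add: lookup_add lookup_single when_def lookup_neighbour_exponent)
    qed
  qed
  ultimately show ?thesis
    by (simp add: pure_power_coeffs_def laplacian_binomial_def right_diff_distrib lookup_minus
        vec_eq_iff axis_def)
qed

text \<open>The polynomials \<open>f\<close> obeying this rule for all \<open>g\<close> form an
  ideal, because constant coefficients are multiplicative, and this ideal contains the
  binomials.\<close>

lemma pure_power_coeffs_mult:
  fixes g :: "('v, 'k::field) mpolynomial"
  assumes "f \<in> laplacian_ideal E w"
  shows "pure_power_coeffs (g * f) = lookup g 0 *s pure_power_coeffs f"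
proof -
  let ?J = "{f :: ('v, 'k) mpolynomial. \<forall>g. pure_power_coeffs (g * f) = lookup g 0 *s pure_power_coeffs f}"
  have "ideal ?J type_ring"
    unfolding ideal_type_ring_iff
    by (auto simp: pure_power_coeffs_zero distrib_left pure_power_coeffs_add
        vector_add_ldistrib lookup_mult_zero vector_smult_assoc simp flip: mult.assoc)
  moreover have "laplacian_binomial i \<in> ?J" for i
    using pure_power_coeffs_mult_binomial[of "1 :: ('v, 'k) mpolynomial" i]
    by (simp add: pure_power_coeffs_mult_binomial) (simp add: vec_eq_iff axis_def)
  ultimately show ?thesis
    using assms laplacian_ideal_subset_iff[of ?J] by blast
qed

text \<open>The members of the Laplacian ideal whose image lies in the span of the images of
  \<open>B\<close> form an ideal containing \<open>B\<close>, hence are all of it. Since the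
  binomials map to the unit vectors, the images of \<open>B\<close> span the whole space.\<close>

lemma card_generators_ge:
  fixes B :: "('v, 'k::field) mpolynomial set"
  assumes fin: "finite B" and B: "genideal type_ring B = laplacian_ideal E w"
  shows "CARD('v) \<le> card B"
proof -
  let ?V = "vec.span (pure_power_coeffs ` B)"
  let ?J = "{f \<in> laplacian_ideal E w. pure_power_coeffs f \<in> ?V}"
  have "ideal ?J type_ring"
    using ideal_laplacian_ideal[where 'k = 'k] unfolding ideal_type_ring_iff
    by (auto simp: pure_power_coeffs_zero pure_power_coeffs_add pure_power_coeffs_mult
        intro: vec.span_zero vec.span_add vec.span_scale)
  moreover have "B \<subseteq> ?J"
    using ring.genideal_self[OF ring_from_type_algebra, of B] B by (auto intro: vec.span_base)
  ultimately have sub: "laplacian_ideal E w \<subseteq> ?J"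
    using ring.genideal_minimal[OF ring_from_type_algebra, of ?J B] B by simp
  have "axis i 1 \<in> ?V" for i
  proof -
    have "pure_power_coeffs (laplacian_binomial i) \<in> ?V"
      using sub laplacian_binomial_in_ideal by blast
    then show ?thesis
      using pure_power_coeffs_mult_binomial[of "1 :: ('v, 'k) mpolynomial" i] by simp
  qed
  then have "cart_basis \<subseteq> ?V"
    by (auto simp: cart_basis_def)
  then have "vec.span cart_basis \<subseteq> ?V"
    by (rule vec.span_minimal) (rule vec.subspace_span)
  then have "vec.dim (UNIV :: ('k ^ 'v) set) \<le> card (pure_power_coeffs ` B)"
    using fin by (intro vec.dim_le_card) auto
  also have "\<dots> \<le> card B"
    by (rule card_image_le[OF fin])
  finally show ?thesis
    by (simp only: vec_dim_card)
qed

lemma min_num_generators_laplacian_ideal: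
  "min_num_generators type_ring (laplacian_ideal E w :: ('v, 'k::field) mpolynomial set) = enat (CARD('v))"
proof (rule antisym)
  let ?B = "range (laplacian_binomial :: 'v \<Rightarrow> ('v, 'k) mpolynomial)"
  have "min_num_generators type_ring (laplacian_ideal E w :: ('v, 'k) mpolynomial set)
      \<le> enat (card ?B)"
    unfolding min_num_generators_def
    by (rule INF_lower[where f = "\<lambda>B. enat (card B)"]) (simp add: laplacian_ideal_eq)
  also have "\<dots> \<le> enat (CARD('v))"
    by (simp add: card_image_le)
  finally show "min_num_generators type_ring (laplacian_ideal E w :: ('v, 'k) mpolynomial set)
      \<le> enat (CARD('v))" .
  show "enat (CARD('v))
      \<le> min_num_generators type_ring (laplacian_ideal E w :: ('v, 'k) mpolynomial set)"
    unfolding min_num_generators_def using card_generators_ge by (intro INF_greatest) auto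
qed

end

end

theorem proposition7p3:
  fixes E :: "'v::finite set set" and w :: "'v set \<Rightarrow> nat"
  assumes "connected_weighted_graph E w"
    and "\<And>i. card (incident_edges E i) \<ge> 2"
  shows "almost_complete_intersection
    (polynomial_ring :: ('v, 'k::field) mpolynomial ring) (laplacian_ideal E w)"
proof -
  interpret connected_weighted_graph E w by fact
  \<comment> \<open>The truncated subtraction is harmless, since there is at least one
    vertex.\<close>
  have "enat (CARD('v)) = enat (CARD('v) - 1) + 1"
    by (simp add: one_enat_def)
  then show ?thesis
    using ideal_laplacian_ideal[where 'k = 'k] ideal_height_laplacian_ideal[where 'k = 'k]
      min_num_generators_laplacian_ideal[OF assms(2), where 'k = 'k]
    unfolding almost_complete_intersection_def polynomial_ring_def by (metis enat.distinct(1))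
qed

end
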